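(* Let $A$ and $B$ be complex square matrices of the same size $d\times d$. For each positive integer $n$, consider all $\binom{2n}{n}$ products of the form $\prod_{i=1}^{2n} e^{w[i]/n}$ for $w \in \mathcal{W}_n$. Among these products (indexed by the words $w\in\mathcal{W}_n$), the proportion of those for which $$\left\| \prod_{i=1}^{2n} e^{w[i]/n} - e^{A+B}\right\| < \sqrt{\frac{\ln n}{n}}$$ goes to $1$ as $n \to \infty$.
   Context: $\mathcal{W}_n$ denotes the set of all words of length $2n$ in two formal (distinct) letters $A$ and $B$ which contain exactly $n$ $A$'s and $n$ $B$'s; so $|\mathcal{W}_n| = \binom{2n}{n}$. $w[i]$ denotes the $i$-th letter of $w$; inside the exponential it is interpreted as the corresponding matrix $A$ or $B$. Products are taken in order from left to right: $\prod_{i=1}^{2n} e^{w[i]/n} = e^{w[1]/n}e^{w[2]/n}\cdots e^{w[2n]/n}$. $\|\cdot\|$ is a fixed sub-multiplicative norm on the space $M_d(\mathbb{C})$ of complex $d\times d$ matrices (such as the operator norm or the Frobenius norm). *)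

theory Defs
  imports "HOL-Analysis.Analysis"
begin

text \<open>
  The type class multiplication on \<^typ>\<open>complex^'d^'d\<close> is componentwise, so neither
  the library's power nor its \<^const>\<open>exp\<close> is the matrix notion; both are built from
  \<^term>\<open>(**)\<close> here.
\<close>

primrec matpow :: "complex^'d^'d \<Rightarrow> nat \<Rightarrow> complex^'d^'d" where
  "matpow X 0 = mat 1"
| "matpow X (Suc k) = X ** matpow X k"

definition matexp :: "complex^'d^'d \<Rightarrow> complex^'d^'d" where
  "matexp X = (\<Sum>k. matpow X k /\<^sub>R fact k)"

definition submult_norm :: "(complex^'d^'d \<Rightarrow> real) \<Rightarrow> bool" where
  "submult_norm N \<longleftrightarrow>
     (\<forall>X. 0 \<le> N X) \<and>
     (\<forall>X. N X = 0 \<longleftrightarrow> X = 0) \<and>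
     (\<forall>c X. N (\<chi> i j. c * X $ i $ j) = cmod c * N X) \<and>
     (\<forall>X Y. N (X + Y) \<le> N X + N Y) \<and>
     (\<forall>X Y. N (X ** Y) \<le> N X * N Y)"

text \<open>Letters are formal, so words stay distinct even when the two matrices coincide.\<close>

datatype letter = LetterA | LetterB

definition words :: "nat \<Rightarrow> letter list set" where
  "words n = {w. length w = 2 * n \<and> count_list w LetterA = n \<and> count_list w LetterB = n}"

fun letter_matrix :: "complex^'d^'d \<Rightarrow> complex^'d^'d \<Rightarrow> letter \<Rightarrow> complex^'d^'d" where
  "letter_matrix A B LetterA = A"
| "letter_matrix A B LetterB = B"

definition word_product :: "complex^'d^'d \<Rightarrow> complex^'d^'d \<Rightarrow> nat \<Rightarrow> letter list \<Rightarrow> complex^'d^'d" where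
  "word_product A B n w =
     foldr (**) (map (\<lambda>l. matexp (letter_matrix A B l /\<^sub>R real n)) w) (mat 1)"

end

theory Submission
  imports Defs
begin

text \<open>
  Write \<open>A = m + d\<close> and \<open>B = m - d\<close> with \<open>m = (A + B)/2\<close>, so that a word becomes a sequence of signs
  \<open>s\<^sub>k\<close>. Replacing the factors of the product one at a time by \<open>e\<^bsup>m/n\<^esup>\<close> gives the deviation from
  \<open>e\<^bsup>2m\<^esup>\<close> as \<open>1/n\<close> times a sum of \<open>s\<^sub>k Y\<^sub>k\<close>, up to \<open>O(1/n)\<close>, where consecutive \<open>Y\<^sub>k\<close> differ by
  \<open>O(1/n)\<close>. Summation by parts then bounds the deviation by \<open>O(1/n\<^sup>2)\<close> times the sum of the
  absolute partial sums of the signs, plus \<open>O(1/n)\<close>. The signs of a random balanced word are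
  negatively correlated, so the partial sums have second moment at most \<open>2n\<close>; hence the mean
  deviation is \<open>O(1/\<surd>n)\<close>, and Markov's inequality at the threshold \<open>sqrt (ln n / n)\<close> leaves a
  proportion \<open>O(1/sqrt (ln n))\<close> of exceptions.
\<close>

subsection \<open>Bounded operators as a Banach algebra\<close>

text \<open>Composition is a multiplication only when domain and codomain agree, so a class instance
  cannot live on \<open>\<Rightarrow>\<^sub>L\<close> itself. On this one-parameter copy
  \<open>exp\<close> and its addition law become available.\<close>

typedef (overloaded) 'a endo = "UNIV :: ('a::real_normed_vector \<Rightarrow>\<^sub>L 'a) set"
  by blast

setup_lifting type_definition_endo

instantiation endo :: (real_normed_vector) real_normed_vector
begin

lift_definition norm_endo :: "'a endo \<Rightarrow> real" is norm .
lift_definition minus_endo :: "'a endo \<Rightarrow> 'a endo \<Rightarrow> 'a endo" is minus .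
lift_definition uminus_endo :: "'a endo \<Rightarrow> 'a endo" is uminus .
lift_definition zero_endo :: "'a endo" is 0 .
lift_definition plus_endo :: "'a endo \<Rightarrow> 'a endo \<Rightarrow> 'a endo" is plus .
lift_definition scaleR_endo :: "real \<Rightarrow> 'a endo \<Rightarrow> 'a endo" is scaleR .

definition dist_endo :: "'a endo \<Rightarrow> 'a endo \<Rightarrow> real"
  where "dist_endo a b = norm (a - b)"

definition uniformity_endo :: "('a endo \<times> 'a endo) filter"
  where "uniformity_endo = (INF e\<in>{0 <..}. principal {(x, y). dist x y < e})"

definition open_endo :: "'a endo set \<Rightarrow> bool"
  where "open_endo S = (\<forall>x\<in>S. \<forall>\<^sub>F (x', y) in uniformity. x' = x \<longrightarrow> y \<in> S)"

definition sgn_endo :: "'a endo \<Rightarrow> 'a endo"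
  where "sgn_endo x = inverse (norm x) *\<^sub>R x"

instance
  by standard
    (unfold dist_endo_def open_endo_def sgn_endo_def uniformity_endo_def,
      (rule refl | (transfer, simp add: algebra_simps norm_triangle_ineq))+)

end

text \<open>\<open>Rep_endo\<close> is an isometry onto the bounded operators, so completeness is
  inherited from them.\<close>

instance endo :: (banach) banach
proof
  fix X :: "nat \<Rightarrow> 'a endo"
  assume X: "Cauchy X"
  have d: "dist (Rep_endo x) (Rep_endo y) = dist x y" for x y :: "'a endo"
    by (simp add: dist_norm norm_endo.rep_eq minus_endo.rep_eq)
  have "Cauchy (\<lambda>i. Rep_endo (X i))"
    using X by (simp add: Cauchy_def d)
  then obtain L where "(\<lambda>i. Rep_endo (X i)) \<longlonglongrightarrow> L"
    using Cauchy_convergent convergent_def by blast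
  then have "X \<longlonglongrightarrow> Abs_endo L"
    by (simp add: lim_sequentially d [symmetric] Abs_endo_inverse)
  then show "convergent X"
    by (auto simp: convergent_def)
qed

text \<open>\<^class>\<open>perfect_space\<close> excludes the zero space, where the identity has norm 0.\<close>

instantiation endo :: ("{real_normed_vector, perfect_space}") real_normed_algebra_1
begin

lift_definition times_endo :: "'a endo \<Rightarrow> 'a endo \<Rightarrow> 'a endo" is blinfun_compose .
lift_definition one_endo :: "'a endo" is id_blinfun .

instance
proof
  fix a b c :: "'a endo" and r :: real
  show "a * b * c = a * (b * c)"
    by transfer (auto intro!: blinfun_eqI)
  show "(a + b) * c = a * c + b * c" "a * (b + c) = a * b + a * c"
    "1 * a = a" "a * 1 = a" "r *\<^sub>R a * b = r *\<^sub>R (a * b)" "a * r *\<^sub>R b = r *\<^sub>R (a * b)"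
    by (transfer, auto intro!: blinfun_eqI simp: blinfun.bilinear_simps)+
  show "norm (a * b) \<le> norm a * norm b"
    by transfer (rule norm_blinfun_compose)
  show norm1: "norm (1 :: 'a endo) = 1"
    by transfer (rule norm_blinfun_id)
  show "(0 :: 'a endo) \<noteq> 1"
    by (metis norm1 norm_zero zero_neq_one)
qed

end

section \<open>Matrices as operators on column vectors\<close>

text \<open>This map is a homomorphism of algebras; it carries matrix products and exponentials into
  the Banach algebra, where all estimates are made.\<close>

lift_definition endo_of_matrix :: "complex^'d^'d \<Rightarrow> (complex^'d) endo"
  is "\<lambda>X. Blinfun ((*v) X)" .

lemma apply_endo_of_matrix: "blinfun_apply (Rep_endo (endo_of_matrix X)) v = X *v v"
  by (simp add: endo_of_matrix.rep_eq bounded_linear_Blinfun_apply)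

lemma endo_eqI: "(\<And>v. blinfun_apply (Rep_endo a) v = blinfun_apply (Rep_endo b) v) \<Longrightarrow> a = b"
  by (simp add: Rep_endo_inject [symmetric] blinfun_eqI)

lemma endo_of_matrix_add: "endo_of_matrix (X + Y) = endo_of_matrix X + endo_of_matrix Y"
  by (rule endo_eqI)
    (simp add: apply_endo_of_matrix plus_endo.rep_eq blinfun.bilinear_simps matrix_vector_mult_add_rdistrib)

lemma scaleR_matrix_vector_mult: "(r *\<^sub>R X) *v v = r *\<^sub>R (X *v v)" for X :: "complex^'d^'d"
  by (simp add: vec_eq_iff matrix_vector_mult_def scaleR_sum_right)

lemma endo_of_matrix_scaleR: "endo_of_matrix (r *\<^sub>R X) = r *\<^sub>R endo_of_matrix X"
  by (rule endo_eqI)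
    (simp add: apply_endo_of_matrix scaleR_endo.rep_eq blinfun.bilinear_simps scaleR_matrix_vector_mult)

lemma endo_of_matrix_mult: "endo_of_matrix (X ** Y) = endo_of_matrix X * endo_of_matrix Y"
  by (rule endo_eqI)
    (simp add: apply_endo_of_matrix times_endo.rep_eq matrix_vector_mul_assoc)

lemma endo_of_matrix_mat_1: "endo_of_matrix (mat 1) = 1"
  by (rule endo_eqI) (simp add: apply_endo_of_matrix one_endo.rep_eq)

lemma linear_endo_of_matrix: "linear endo_of_matrix"
  by (rule linearI) (simp_all add: endo_of_matrix_add endo_of_matrix_scaleR)

lemma bounded_linear_endo_of_matrix: "bounded_linear endo_of_matrix"
  using linear_endo_of_matrix linear_conv_bounded_linear by blast

section \<open>Comparison of matrix norms with the operator norm\<close>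

text \<open>The entry is a coordinate of the image of a standard basis vector, which has norm
  1.\<close>

lemma norm_component_le_endo: "norm (X $ i $ j) \<le> norm (endo_of_matrix X)"
proof -
  have "X $ i $ j = (X *v axis j 1) $ i"
    by (simp add: matrix_vector_mult_def axis_def if_distrib [of "(*) _"] cong: if_cong)
  also have "norm \<dots> \<le> norm (X *v axis j 1)"
    by (rule Finite_Cartesian_Product.norm_nth_le)
  also have "\<dots> \<le> norm (endo_of_matrix X)"
    using norm_blinfun [of "Rep_endo (endo_of_matrix X)" "axis j 1"]
    by (simp add: apply_endo_of_matrix norm_endo.rep_eq)
  finally show ?thesis .
qed

text \<open>Expansion in matrix units. The scalar acts entrywise to match the homogeneity clause of
  \<open>submult_norm\<close>.\<close>

lemma matrix_eq_sum_units:
  fixes X :: "complex^'d^'d"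
  shows "X = (\<Sum>i\<in>UNIV. \<Sum>j\<in>UNIV. (\<chi> a b. X $ i $ j * (axis i (axis j 1)) $ a $ b))"
proof -
  have "(\<Sum>i\<in>UNIV. \<Sum>j\<in>UNIV. X $ i $ j * axis i (axis j 1) $ a $ b) = X $ a $ b" for a b
  proof -
    have "(\<Sum>i\<in>UNIV. \<Sum>j\<in>UNIV. X $ i $ j * axis i (axis j 1) $ a $ b)
        = (\<Sum>i\<in>UNIV. if i = a then \<Sum>j\<in>UNIV. if j = b then X $ i $ j else 0 else 0)"
      by (intro sum.cong refl) (simp add: axis_def if_distrib [of "(*) _"] eq_commute cong: if_cong)
    then show ?thesis by simp
  qed
  then show ?thesis
    by (simp add: vec_eq_iff)
qed

lemma submult_norm_sum_le:
  assumes "submult_norm N" "finite I"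
  shows "N (sum f I) \<le> (\<Sum>i\<in>I. N (f i))"
  using assms(2)
proof (induction I)
  case empty
  have "N 0 = 0"
    using assms(1) by (simp add: submult_norm_def)
  then show ?case by simp
next
  case (insert i I)
  have "N (f i + sum f I) \<le> N (f i) + N (sum f I)"
    using assms(1) by (auto simp: submult_norm_def)
  with insert show ?case by simp
qed

text \<open>The expansion in matrix units bounds \<open>N\<close> by the entries, and these by the
  operator norm. This direction suffices to carry upper bounds on the deviation over to
  \<open>N\<close>.\<close>

lemma submult_norm_le_endo:
  fixes N :: "complex^'d^'d \<Rightarrow> real"
  assumes N: "submult_norm N"
  obtains c where "c > 0" "\<And>X. N X \<le> c * norm (endo_of_matrix X)"
proof
  define U :: "'d \<Rightarrow> 'd \<Rightarrow> complex^'d^'d" where "U i j = axis i (axis j 1)" for i j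
  \<comment> \<open>The summand 1 gives positivity without evaluating \<open>N\<close> on any matrix
    unit.\<close>
  let ?c = "1 + (\<Sum>i\<in>UNIV. \<Sum>j\<in>UNIV. N (U i j))"
  have N0: "N X \<ge> 0" for X
    using N by (simp add: submult_norm_def)
  show "?c > 0"
    using N0 by (simp add: add_pos_nonneg sum_nonneg)
  fix X :: "complex^'d^'d"
  have "N X = N (\<Sum>i\<in>UNIV. \<Sum>j\<in>UNIV. (\<chi> a b. X $ i $ j * U i j $ a $ b))"
    unfolding U_def by (subst (1) matrix_eq_sum_units) (rule refl)
  also have "\<dots> \<le> (\<Sum>i\<in>UNIV. \<Sum>j\<in>UNIV. N (\<chi> a b. X $ i $ j * U i j $ a $ b))"
    by (intro order.trans [OF submult_norm_sum_le [OF N]] sum_mono submult_norm_sum_le [OF N]) simp_all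
  also have "\<dots> = (\<Sum>i\<in>UNIV. \<Sum>j\<in>UNIV. norm (X $ i $ j) * N (U i j))"
    using N by (simp add: submult_norm_def)
  also have "\<dots> \<le> (\<Sum>i\<in>UNIV. \<Sum>j\<in>UNIV. norm (endo_of_matrix X) * N (U i j))"
    by (intro sum_mono mult_right_mono norm_component_le_endo N0)
  also have "\<dots> \<le> ?c * norm (endo_of_matrix X)"
    by (simp add: sum_distrib_left [symmetric] algebra_simps)
  finally show "N X \<le> ?c * norm (endo_of_matrix X)" .
qed

text \<open>A Euclidean norm is at most the sum of the absolute entries. The bound serves to prove
  convergence of the exponential series in the matrix space itself.\<close>

lemma norm_matrix_le_endo:
  fixes X :: "complex^'d^'d"
  shows "norm X \<le> real CARD('d) ^ 2 * norm (endo_of_matrix X)"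
proof -
  have "norm X \<le> (\<Sum>i\<in>UNIV. norm (X $ i))"
    unfolding norm_vec_def by (intro L2_set_le_sum) simp
  also have "\<dots> \<le> (\<Sum>i\<in>UNIV. \<Sum>j\<in>UNIV. norm (X $ i $ j))"
    by (intro sum_mono, subst norm_vec_def, intro L2_set_le_sum) simp
  also have "\<dots> \<le> (\<Sum>i\<in>(UNIV::'d set). \<Sum>j\<in>(UNIV::'d set). norm (endo_of_matrix X))"
    by (intro sum_mono norm_component_le_endo)
  finally show ?thesis by (simp add: power2_eq_square mult.assoc)
qed

section \<open>Matrix exponentials and word products as operators\<close>

lemma endo_of_matrix_matpow: "endo_of_matrix (matpow X k) = endo_of_matrix X ^ k"
  by (induction k) (simp_all add: endo_of_matrix_mat_1 endo_of_matrix_mult)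

lemma endo_of_matrix_matexp: "endo_of_matrix (matexp X) = exp (endo_of_matrix X)"
proof -
  let ?f = "\<lambda>k. matpow X k /\<^sub>R fact k"
  have h: "endo_of_matrix (?f k) = endo_of_matrix X ^ k /\<^sub>R fact k" for k
    by (simp add: endo_of_matrix_scaleR endo_of_matrix_matpow)
  \<comment> \<open>A bounded linear map may be moved inside \<open>suminf\<close> only once the
    series is known to converge.\<close>
  have "summable ?f"
  proof (rule summable_comparison_test')
    show "summable (\<lambda>k. real CARD('a) ^ 2 * norm (endo_of_matrix X ^ k /\<^sub>R fact k))"
      by (intro summable_mult summable_norm_exp)
    show "norm (?f k) \<le> real CARD('a) ^ 2 * norm (endo_of_matrix X ^ k /\<^sub>R fact k)" for k
      using norm_matrix_le_endo [of "?f k"] by (simp only: h)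
  qed
  then show ?thesis
    unfolding matexp_def exp_def
    by (simp only: bounded_linear.suminf [OF bounded_linear_endo_of_matrix] h)
qed

lemma endo_of_word_product:
  "endo_of_matrix (word_product A B n w)
    = prod_list (map (\<lambda>l. exp (endo_of_matrix (letter_matrix A B l) /\<^sub>R real n)) w)"
  unfolding word_product_def
  by (induction w)
    (simp_all add: endo_of_matrix_mat_1 endo_of_matrix_mult endo_of_matrix_matexp endo_of_matrix_scaleR)

subsection \<open>Products of exponentials with balanced signs\<close>

text \<open>Without its constant term the series has a factor \<open>norm y\<close>; by 1/(n+1)!
  \<le> 1/n! what remains is dominated by the exponential series.\<close>

lemma norm_exp_diff_le:
  fixes y :: "'a::{real_normed_algebra_1,banach}"
  shows "norm (exp y - 1) \<le> norm y * exp (norm y)"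
proof -
  have s: "summable (\<lambda>n. norm y * (norm y ^ n /\<^sub>R fact n))"
    by (intro summable_mult summable_exp_generic)
  have le: "norm (inverse (fact (Suc n)) *\<^sub>R y ^ Suc n) \<le> norm y * (norm y ^ n /\<^sub>R fact n)" for n
  proof -
    have "norm (inverse (fact (Suc n)) *\<^sub>R y ^ Suc n) \<le> inverse (fact (Suc n)) * norm y ^ Suc n"
      using norm_power_ineq [of y "Suc n"] by (simp add: mult_left_mono del: power_Suc fact_Suc)
    also have "\<dots> \<le> inverse (fact n) * norm y ^ Suc n"
      by (intro mult_right_mono le_imp_inverse_le fact_mono) simp_all
    finally show ?thesis by (simp add: mult_ac)
  qed
  have "norm (exp y - 1) = norm (\<Sum>n. inverse (fact (Suc n)) *\<^sub>R y ^ Suc n)"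
    using exp_first_term [of y] by simp
  also have "\<dots> \<le> (\<Sum>n. norm y * (norm y ^ n /\<^sub>R fact n))"
    by (rule norm_suminf_le [OF le s])
  also have "\<dots> = norm y * exp (norm y)"
    by (simp only: exp_def suminf_mult [OF summable_exp_generic])
  finally show ?thesis .
qed

text \<open>The same argument with two terms removed, giving a quadratic factor.\<close>

lemma norm_exp_diff_linear_le:
  fixes y :: "'a::{real_normed_algebra_1,banach}"
  shows "norm (exp y - 1 - y) \<le> (norm y)\<^sup>2 * exp (norm y)"
proof -
  have s: "summable (\<lambda>n. (norm y)\<^sup>2 * (norm y ^ n /\<^sub>R fact n))"
    by (intro summable_mult summable_exp_generic)
  have le: "norm (inverse (fact (n + 2)) *\<^sub>R y ^ (n + 2)) \<le> (norm y)\<^sup>2 * (norm y ^ n /\<^sub>R fact n)" for n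
  proof -
    have "norm (inverse (fact (n + 2)) *\<^sub>R y ^ (n + 2)) \<le> inverse (fact (n + 2)) * norm y ^ (n + 2)"
      using norm_power_ineq [of y "n + 2"] by (simp add: mult_left_mono del: power_Suc fact_Suc)
    also have "\<dots> \<le> inverse (fact n) * norm y ^ (n + 2)"
      by (intro mult_right_mono le_imp_inverse_le fact_mono) simp_all
    finally show ?thesis by (simp add: power_add power2_eq_square mult_ac)
  qed
  have "norm (exp y - 1 - y) = norm (\<Sum>n. inverse (fact (n + 2)) *\<^sub>R y ^ (n + 2))"
    using exp_first_two_terms [of y] by simp
  also have "\<dots> \<le> (\<Sum>n. (norm y)\<^sup>2 * (norm y ^ n /\<^sub>R fact n))"
    by (rule norm_suminf_le [OF le s])
  also have "\<dots> = (norm y)\<^sup>2 * exp (norm y)"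
    by (simp only: exp_def suminf_mult [OF summable_exp_generic])
  finally show ?thesis .
qed

text \<open>Abel summation; for balanced signs the boundary term vanishes at the full length,
  leaving only the small increments of \<open>Y\<close>.\<close>

lemma summation_by_parts:
  fixes s :: "nat \<Rightarrow> real" and Y :: "nat \<Rightarrow> 'a::real_vector"
  shows "(\<Sum>k<L. s k *\<^sub>R Y k)
    = (\<Sum>i<L. s i) *\<^sub>R Y L - (\<Sum>k<L. (\<Sum>i<Suc k. s i) *\<^sub>R (Y (Suc k) - Y k))"
  by (induction L) (simp_all add: algebra_simps)

text \<open>The deterministic half of the argument: \<open>m\<close> and \<open>d\<close> need not
  commute, and the signs enter only through their absolute partial sums. The leading constant is
  independent of \<open>n\<close>.\<close>

lemma prod_list_exp_deviation:
  fixes m d :: "'a::{real_normed_algebra_1,banach}" and s :: "nat \<Rightarrow> real"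
  defines "K \<equiv> norm m + norm d"
  assumes n: "n > 0" and s: "\<And>i. \<bar>s i\<bar> \<le> 1" and bal: "(\<Sum>i<2 * n. s i) = 0"
  shows "norm (prod_list (map (\<lambda>i. exp ((m + s i *\<^sub>R d) /\<^sub>R real n)) [0..<2 * n]) - exp (2 *\<^sub>R m))
    \<le> 4 * K\<^sup>2 * exp (6 * K) * ((\<Sum>k<2 * n. \<bar>\<Sum>i<Suc k. s i\<bar>) / (real n)\<^sup>2 + 1 / real n)"
proof -
  define x where "x k = (m + s k *\<^sub>R d) /\<^sub>R real n" for k
  define P where "P k = prod_list (map (\<lambda>i. exp (x i)) [0..<k])" for k
  \<comment> \<open>\<open>E k\<close> replaces the factors from position \<open>k\<close> onwards
    by copies of exp(m/n), so \<open>P k * E k\<close> interpolates between the two sides.\<close>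
  define E where "E k = exp (((2 * real n - real k) / real n) *\<^sub>R m)" for k
  define Y where "Y k = P k * d * E (Suc k)" for k
  define r where "r k = exp (x k) - exp (m /\<^sub>R real n) - (s k / real n) *\<^sub>R d" for k
  have K0: "K \<ge> 0" and dK: "norm d \<le> K" and mK: "norm m \<le> K"
    by (simp_all add: K_def)
  have P_Suc: "P (Suc k) = P k * exp (x k)" for k
    by (simp add: P_def)
  have E_Suc: "E k = exp (m /\<^sub>R real n) * E (Suc k)" for k
  proof -
    have "((2 * real n - real k) / real n) *\<^sub>R m
        = m /\<^sub>R real n + ((2 * real n - real (Suc k)) / real n) *\<^sub>R m"
      using n by (simp add: scaleR_add_left [symmetric] divide_simps)
    then show ?thesis
      unfolding E_def by (simp add: exp_add_commuting)
  qed
  have x_le: "norm (x k) \<le> K / real n" for k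
  proof -
    have "norm (m + s k *\<^sub>R d) \<le> norm m + \<bar>s k\<bar> * norm d"
      using norm_triangle_ineq [of m "s k *\<^sub>R d"] by simp
    also have "\<dots> \<le> K"
      using s [of k] mult_right_mono [of "\<bar>s k\<bar>" 1 "norm d"] by (simp add: K_def)
    finally show ?thesis
      using n by (simp add: x_def divide_simps)
  qed
  have m_le: "norm (m /\<^sub>R real n) \<le> K / real n"
    using n mK by (simp add: divide_simps)
  have Kn: "K / real n \<le> K"
    using n K0 by (simp add: divide_le_eq mult_le_cancel_left1)
  have P_le: "norm (P k) \<le> exp (K * real k / real n)" for k
  proof (induction k)
    case 0
    then show ?case by (simp add: P_def)
  next
    case (Suc k)
    have "norm (P (Suc k)) \<le> norm (P k) * norm (exp (x k))"
      unfolding P_Suc by (rule norm_mult_ineq)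
    also have "\<dots> \<le> exp (K * real k / real n) * exp (K / real n)"
      using x_le [of k] norm_exp [of "x k"] by (intro mult_mono Suc) (auto intro: order.trans)
    finally show ?case
      by (simp add: exp_add [symmetric] add_divide_distrib algebra_simps)
  qed
  have P_bound: "norm (P k) \<le> exp (2 * K)" if "k \<le> 2 * n" for k
  proof -
    have "K * real k / real n \<le> 2 * K"
      using that n K0 mult_left_mono [of "real k" "2 * real n" K] by (simp add: divide_simps mult_ac)
    then show ?thesis
      using P_le [of k] by (meson exp_le_cancel_iff order.trans)
  qed
  \<comment> \<open>Index 2n+1 occurs in \<open>Y (2 * n)\<close>; the coefficient of
    \<open>m\<close> there is -1/n, still at most 2 in absolute value.\<close>
  have E_bound: "norm (E k) \<le> exp (2 * K)" if "k \<le> Suc (2 * n)" for k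
  proof -
    have "\<bar>2 * real n - real k\<bar> \<le> 2 * real n"
      using that n by linarith
    then have "\<bar>2 * real n - real k\<bar> / real n \<le> 2"
      using n by (simp add: divide_simps)
    then have "\<bar>2 * real n - real k\<bar> / real n * norm m \<le> 2 * K"
      using mK K0 n by (intro mult_mono) auto
    then have "norm (((2 * real n - real k) / real n) *\<^sub>R m) \<le> 2 * K"
      by simp
    then show ?thesis
      unfolding E_def by (meson norm_exp exp_le_cancel_iff order.trans)
  qed
  have exp_diff: "norm (exp y - 1) \<le> K / real n * exp K" if "norm y \<le> K / real n" for y :: 'a
  proof -
    have "norm (exp y - 1) \<le> norm y * exp (norm y)"
      by (rule norm_exp_diff_le)
    also have "\<dots> \<le> K / real n * exp K"
      using that Kn K0 by (intro mult_mono) auto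
    finally show ?thesis .
  qed
  have exp_diff2: "norm (exp y - 1 - y) \<le> (K / real n)\<^sup>2 * exp K" if "norm y \<le> K / real n" for y :: 'a
  proof -
    have "norm (exp y - 1 - y) \<le> (norm y)\<^sup>2 * exp (norm y)"
      by (rule norm_exp_diff_linear_le)
    also have "\<dots> \<le> (K / real n)\<^sup>2 * exp K"
      using that Kn K0 by (intro mult_mono power_mono) auto
    finally show ?thesis .
  qed
  have r_le: "norm (r k) \<le> 2 * ((K / real n)\<^sup>2 * exp K)" for k
  proof -
    \<comment> \<open>The linear parts differ by exactly \<open>(s k / real n) *\<^sub>R d\<close>,
      so only two quadratic remainders are left.\<close>
    have "r k = (exp (x k) - 1 - x k) - (exp (m /\<^sub>R real n) - 1 - m /\<^sub>R real n)"
      by (simp add: r_def x_def algebra_simps divide_inverse)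
    then show ?thesis
      using norm_triangle_ineq4 [of "exp (x k) - 1 - x k" "exp (m /\<^sub>R real n) - 1 - m /\<^sub>R real n"]
        exp_diff2 [OF x_le, of k] exp_diff2 [OF m_le] by simp
  qed
  \<comment> \<open>Consecutive products \<open>P k * E k\<close> differ in a single factor. The
    final bracket lets the induction run over all \<open>L\<close>; it vanishes at 2n, where
    \<open>E\<close> is 1.\<close>
  have tele: "P L - E 0 = (\<Sum>k<L. P k * (exp (x k) - exp (m /\<^sub>R real n)) * E (Suc k)) + (P L - P L * E L)" for L
  proof (induction L)
    case 0
    then show ?case by (simp add: P_def)
  next
    case (Suc L)
    have "P (Suc L) * E (Suc L) - P L * E L = P L * (exp (x L) - exp (m /\<^sub>R real n)) * E (Suc L)"
      by (simp add: P_Suc E_Suc [of L] algebra_simps)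
    with Suc show ?case by (simp add: algebra_simps)
  qed
  have E_end: "E (2 * n) = 1" and E_0: "E 0 = exp (2 *\<^sub>R m)"
    using n by (simp_all add: E_def)
  have "P (2 * n) - exp (2 *\<^sub>R m)
      = (\<Sum>k<2 * n. P k * (exp (x k) - exp (m /\<^sub>R real n)) * E (Suc k))"
    using tele [of "2 * n"] by (simp add: E_end E_0)
  also have "\<dots> = (\<Sum>k<2 * n. (s k / real n) *\<^sub>R Y k + P k * r k * E (Suc k))"
  proof (intro sum.cong refl)
    fix k
    have "exp (x k) - exp (m /\<^sub>R real n) = (s k / real n) *\<^sub>R d + r k"
      by (simp add: r_def)
    then show "P k * (exp (x k) - exp (m /\<^sub>R real n)) * E (Suc k) = (s k / real n) *\<^sub>R Y k + P k * r k * E (Suc k)"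
      by (simp add: Y_def distrib_left distrib_right)
  qed
  also have "\<dots> = (1 / real n) *\<^sub>R (\<Sum>k<2 * n. s k *\<^sub>R Y k) + (\<Sum>k<2 * n. P k * r k * E (Suc k))"
    by (simp add: sum.distrib scaleR_sum_right)
  \<comment> \<open>Balance of the signs removes the boundary term.\<close>
  also have "(\<Sum>k<2 * n. s k *\<^sub>R Y k) = - (\<Sum>k<2 * n. (\<Sum>i<Suc k. s i) *\<^sub>R (Y (Suc k) - Y k))"
    using summation_by_parts [of s Y "2 * n"] by (simp only: bal) simp
  finally have main: "P (2 * n) - exp (2 *\<^sub>R m)
      = (\<Sum>k<2 * n. P k * r k * E (Suc k)) - (1 / real n) *\<^sub>R (\<Sum>k<2 * n. (\<Sum>i<Suc k. s i) *\<^sub>R (Y (Suc k) - Y k))"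
    by simp
  \<comment> \<open>The three factors bound the prefix, the replaced middle part and the suffix; the
    exponent 5K is rounded up.\<close>
  have e6: "exp (2 * K) * exp K * exp (2 * K) \<le> exp (6 * K)"
    using K0 by (simp add: exp_add [symmetric])
  have rest: "norm (P k * r k * E (Suc k)) \<le> 2 * (K / real n)\<^sup>2 * exp (6 * K)" if k: "k < 2 * n" for k
  proof -
    have "norm (P k * r k * E (Suc k)) \<le> norm (P k) * norm (r k) * norm (E (Suc k))"
      by (meson norm_mult_ineq mult_right_mono norm_ge_zero order.trans)
    also have "\<dots> \<le> exp (2 * K) * (2 * ((K / real n)\<^sup>2 * exp K)) * exp (2 * K)"
      using k by (intro mult_mono P_bound E_bound r_le) auto
    also have "\<dots> = 2 * (K / real n)\<^sup>2 * (exp (2 * K) * exp K * exp (2 * K))"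
      by (simp only: mult_ac)
    also have "\<dots> \<le> 2 * (K / real n)\<^sup>2 * exp (6 * K)"
      by (intro mult_left_mono e6) simp
    finally show ?thesis .
  qed
  have Y_diff: "norm (Y (Suc k) - Y k) \<le> 2 * K\<^sup>2 * exp (6 * K) / real n" if k: "k < 2 * n" for k
  proof -
    define q where "q = exp (m /\<^sub>R real n)"
    \<comment> \<open>Subtracting \<open>d\<close> from both \<open>exp (x k) * d\<close> and
      \<open>d * q\<close> exposes two terms of size O(1/n), without commuting \<open>d\<close> past
      an exponential.\<close>
    have Y_eq: "Y (Suc k) - Y k = P k * ((exp (x k) - 1) * d - d * (q - 1)) * E (Suc (Suc k))"
      by (simp add: Y_def P_Suc E_Suc [of "Suc k"] q_def algebra_simps)
    have "norm ((exp (x k) - 1) * d - d * (q - 1)) \<le> norm ((exp (x k) - 1) * d) + norm (d * (q - 1))"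
      by (rule norm_triangle_ineq4)
    also have "\<dots> \<le> (K / real n * exp K) * K + K * (K / real n * exp K)"
      unfolding q_def
      by (intro add_mono order.trans [OF norm_mult_ineq] mult_mono exp_diff x_le m_le dK) (use K0 in auto)
    finally have mid: "norm ((exp (x k) - 1) * d - d * (q - 1)) \<le> 2 * K\<^sup>2 * exp K / real n"
      by (simp add: power2_eq_square)
    have "norm (Y (Suc k) - Y k) \<le> norm (P k) * norm ((exp (x k) - 1) * d - d * (q - 1)) * norm (E (Suc (Suc k)))"
      unfolding Y_eq by (meson norm_mult_ineq mult_right_mono norm_ge_zero order.trans)
    also have "\<dots> \<le> exp (2 * K) * (2 * K\<^sup>2 * exp K / real n) * exp (2 * K)"
      using k by (intro mult_mono P_bound E_bound mid) auto
    also have "\<dots> = 2 * K\<^sup>2 / real n * (exp (2 * K) * exp K * exp (2 * K))"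
      by simp
    also have "\<dots> \<le> 2 * K\<^sup>2 / real n * exp (6 * K)"
      by (intro mult_left_mono e6) simp
    finally show ?thesis by simp
  qed
  have "norm (P (2 * n) - exp (2 *\<^sub>R m))
      \<le> (\<Sum>k<2 * n. norm (P k * r k * E (Suc k)))
        + 1 / real n * (\<Sum>k<2 * n. \<bar>\<Sum>i<Suc k. s i\<bar> * norm (Y (Suc k) - Y k))"
    unfolding main
    by (rule order.trans [OF norm_triangle_ineq4])
      (auto intro!: add_mono norm_sum order.trans [OF norm_sum] divide_right_mono sum_mono)
  also have "\<dots> \<le> (\<Sum>k<2 * n. 2 * (K / real n)\<^sup>2 * exp (6 * K))
        + 1 / real n * (\<Sum>k<2 * n. \<bar>\<Sum>i<Suc k. s i\<bar> * (2 * K\<^sup>2 * exp (6 * K) / real n))"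
    by (intro add_mono sum_mono mult_left_mono rest Y_diff) auto
  also have "(\<Sum>k<2 * n. \<bar>\<Sum>i<Suc k. s i\<bar> * (2 * K\<^sup>2 * exp (6 * K) / real n))
      = (\<Sum>k<2 * n. \<bar>\<Sum>i<Suc k. s i\<bar>) * (2 * K\<^sup>2 * exp (6 * K) / real n)"
    by (rule sum_distrib_right [symmetric])
  \<comment> \<open>The 2n quadratic remainders together contribute order 1/n, with coefficient 4;
    the coefficient 2 of the other term is raised to 4 afterwards.\<close>
  also have "(\<Sum>k<2 * n. 2 * (K / real n)\<^sup>2 * exp (6 * K)) + 1 / real n * \<dots>
      = 4 * K\<^sup>2 * exp (6 * K) * (1 / real n)
        + 2 * K\<^sup>2 * exp (6 * K) * ((\<Sum>k<2 * n. \<bar>\<Sum>i<Suc k. s i\<bar>) / (real n)\<^sup>2)"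
    using n by (simp add: power2_eq_square mult_ac del: sum.lessThan_Suc)
  also have "\<dots> \<le> 4 * K\<^sup>2 * exp (6 * K) * ((\<Sum>k<2 * n. \<bar>\<Sum>i<Suc k. s i\<bar>) / (real n)\<^sup>2 + 1 / real n)"
    by (simp add: distrib_left mult_right_mono sum_nonneg divide_right_mono del: sum.lessThan_Suc)
  finally show ?thesis
    by (simp add: P_def x_def)
qed

subsection \<open>Random balanced words\<close>

definition letter_sign :: "letter \<Rightarrow> real" where
  "letter_sign l = (if l = LetterA then 1 else -1)"

lemma letter_sign_square [simp]: "letter_sign l * letter_sign l = 1"
  by (simp add: letter_sign_def)

lemma abs_letter_sign [simp]: "\<bar>letter_sign l\<bar> = 1"
  by (simp add: letter_sign_def)

lemma sum_list_letter_sign: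
  "sum_list (map letter_sign w) = real (count_list w LetterA) - real (count_list w LetterB)"
proof (induction w)
  case (Cons l w)
  then show ?case by (cases l) (simp_all add: letter_sign_def)
qed simp

lemma finite_words: "finite (words n)"
proof (rule finite_subset)
  show "words n \<subseteq> {w. set w \<subseteq> {LetterA, LetterB} \<and> length w = 2 * n}"
    by (auto simp: words_def) (metis letter.exhaust)
  show "finite {w. set w \<subseteq> {LetterA, LetterB} \<and> length w = 2 * n}"
    by (rule finite_lists_length_eq) simp
qed

text \<open>Keeps the denominator of the proportion positive.\<close>

lemma words_nonempty: "words n \<noteq> {}"
proof -
  have *: "count_list (replicate k x) y = (if x = y then k else 0)" for k x and y :: letter
    by (induction k) auto
  have "replicate n LetterA @ replicate n LetterB \<in> words n"
    by (simp add: words_def *)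
  then show ?thesis by blast
qed

lemma sum_letter_sign_word:
  assumes "w \<in> words n"
  shows "(\<Sum>i<2 * n. letter_sign (w ! i)) = 0"
proof -
  have "(\<Sum>i<2 * n. letter_sign (w ! i)) = sum_list (map letter_sign w)"
    using assms by (simp add: sum_list_sum_nth words_def lessThan_atLeast0)
  then show ?thesis
    using assms by (simp add: sum_list_letter_sign words_def)
qed

text \<open>Exchanging two letters preserves their counts and is an involution, so it permutes the
  balanced words: a uniformly random word is exchangeable.\<close>

lemma sum_words_swap:
  assumes "i < 2 * n" "j < 2 * n"
  shows "(\<Sum>w\<in>words n. f (w[i := w ! j, j := w ! i])) = (\<Sum>w\<in>words n. f w)"
proof -
  let ?s = "\<lambda>w. w[i := w ! j, j := w ! i]"
  have s: "?s w \<in> words n" if "w \<in> words n" for w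
    using that assms mset_swap [of j w i]
    by (simp add: words_def count_mset [symmetric])
  have inv: "?s (?s w) = w" if "w \<in> words n" for w
    using that assms by (intro nth_equalityI) (auto simp: words_def nth_list_update)
  show ?thesis
    by (rule sum.reindex_bij_witness [of _ ?s ?s]) (use s inv in auto)
qed

text \<open>The correlation is the same for all \<open>j \<noteq> i\<close>, and these values sum to minus the variance,
  because the signs of a word sum to 0.\<close>

lemma letter_signs_negatively_correlated:
  assumes ij: "i < 2 * n" "j < 2 * n" "i \<noteq> j"
  shows "(\<Sum>w\<in>words n. letter_sign (w ! i) * letter_sign (w ! j)) \<le> 0"
proof -
  define c where "c j = (\<Sum>w\<in>words n. letter_sign (w ! i) * letter_sign (w ! j))" for j
  have c_eq: "c k = c j" if k: "k < 2 * n" "k \<noteq> i" for k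
  proof -
    \<comment> \<open>Transposing positions \<open>j\<close> and \<open>k\<close> leaves position
      \<open>i\<close> fixed, since both differ from \<open>i\<close>.\<close>
    have "c j = (\<Sum>w\<in>words n. letter_sign (w[j := w ! k, k := w ! j] ! i)
        * letter_sign (w[j := w ! k, k := w ! j] ! j))"
      unfolding c_def
      by (subst sum_words_swap [OF ij(2) k(1), where f = "\<lambda>w. letter_sign (w ! i) * letter_sign (w ! j)"]) (rule refl)
    also have "\<dots> = c k"
      unfolding c_def using ij k by (intro sum.cong) (auto simp: words_def nth_list_update)
    finally show ?thesis by simp
  qed
  have "0 = (\<Sum>k<2 * n. c k)"
    unfolding c_def
    by (subst sum.swap) (simp add: sum_distrib_left [symmetric] sum_letter_sign_word)
  also have "\<dots> = c i + (\<Sum>k\<in>{..<2 * n} - {i}. c k)"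
    using ij by (simp add: sum.remove)
  also have "(\<Sum>k\<in>{..<2 * n} - {i}. c k) = (\<Sum>k\<in>{..<2 * n} - {i}. c j)"
    by (intro sum.cong refl c_eq) auto
  also have "\<dots> = real (2 * n - 1) * c j"
    using ij by simp
  finally have "real (2 * n - 1) * c j = - c i" by simp
  then have "real (2 * n - 1) * c j \<le> 0"
    by (simp add: c_def)
  moreover have "real (2 * n - 1) > 0"
    using ij by simp
  ultimately have "c j \<le> 0"
    unfolding mult_le_0_iff by linarith
  then show ?thesis
    by (simp add: c_def)
qed

text \<open>In the expanded square each of the \<open>k\<close> diagonal terms counts all words, and
  the off-diagonal terms are nonpositive in total by negative correlation.\<close>

lemma sum_letter_sign_square_le:
  assumes k: "k \<le> 2 * n"
  shows "(\<Sum>w\<in>words n. (\<Sum>i<k. letter_sign (w ! i))\<^sup>2) \<le> real k * card (words n)"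
proof -
  have "(\<Sum>w\<in>words n. (\<Sum>i<k. letter_sign (w ! i))\<^sup>2)
      = (\<Sum>i<k. \<Sum>j<k. \<Sum>w\<in>words n. letter_sign (w ! i) * letter_sign (w ! j))"
    by (simp add: power2_eq_square sum_product sum.swap [of _ _ "words n"])
  also have "\<dots> \<le> (\<Sum>i<k. \<Sum>j<k. if i = j then real (card (words n)) else 0)"
  proof (intro sum_mono)
    fix i j assume "i \<in> {..<k}" "j \<in> {..<k}"
    then show "(\<Sum>w\<in>words n. letter_sign (w ! i) * letter_sign (w ! j))
        \<le> (if i = j then real (card (words n)) else 0)"
      using k letter_signs_negatively_correlated [of i n j]
      by simp
  qed
  also have "\<dots> = real k * card (words n)"
    by simp
  finally show ?thesis .
qed

subsection \<open>Concentration\<close>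

lemma sum_abs_walk_le:
  assumes n: "n > 0"
  shows "(\<Sum>w\<in>words n. \<Sum>k<2 * n. \<bar>\<Sum>i<Suc k. letter_sign (w ! i)\<bar>)
    \<le> 3 * real n * sqrt (real n) * card (words n)"
proof -
  define S where "S w k = (\<Sum>i<Suc k. letter_sign (w ! i))" for w k
  \<comment> \<open>With second moment at most 2n, the weight \<open>q\<close> makes both AM-GM
    terms of order \<open>q\<close>: they are at most q and q/2, hence the factor 3/2 below.\<close>
  define q where "q = sqrt (real n)"
  have q: "q > 0" "q * q = real n"
    using n by (simp_all add: q_def)
  \<comment> \<open>AM-GM replaces the absolute value by the square.\<close>
  have amgm: "\<bar>S w k\<bar> \<le> (S w k)\<^sup>2 / (2 * q) + q / 2" for w k
  proof -
    have "0 \<le> (\<bar>S w k\<bar> - q)\<^sup>2" by simp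
    then have "2 * q * \<bar>S w k\<bar> \<le> (S w k)\<^sup>2 + q * q"
      by (simp add: power2_diff power2_eq_square algebra_simps)
    then show ?thesis
      using q(1) by (simp add: field_simps)
  qed
  have "(\<Sum>w\<in>words n. \<Sum>k<2 * n. \<bar>S w k\<bar>) = (\<Sum>k<2 * n. \<Sum>w\<in>words n. \<bar>S w k\<bar>)"
    by (rule sum.swap)
  also have "\<dots> \<le> (\<Sum>k<2 * n. 3 / 2 * q * card (words n))"
  proof (intro sum_mono)
    fix k assume k: "k \<in> {..<2 * n}"
    have "(\<Sum>w\<in>words n. \<bar>S w k\<bar>) \<le> (\<Sum>w\<in>words n. (S w k)\<^sup>2 / (2 * q) + q / 2)"
      by (intro sum_mono amgm)
    also have "\<dots> = (\<Sum>w\<in>words n. (S w k)\<^sup>2) / (2 * q) + q / 2 * card (words n)"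
      by (simp add: sum.distrib sum_divide_distrib)
    also have "(\<Sum>w\<in>words n. (S w k)\<^sup>2) \<le> real (Suc k) * card (words n)"
      unfolding S_def using k by (intro sum_letter_sign_square_le) auto
    also have "\<dots> \<le> (2 * (q * q)) * card (words n)"
      using k by (intro mult_right_mono) (simp_all add: q(2))
    finally show "(\<Sum>w\<in>words n. \<bar>S w k\<bar>) \<le> 3 / 2 * q * card (words n)"
      using q(1) by (simp add: divide_right_mono algebra_simps)
  qed
  also have "\<dots> = 3 * real n * q * card (words n)"
    by simp
  finally show ?thesis
    by (simp add: S_def q_def)
qed

text \<open>The deterministic bound is averaged over all words. The constant may depend on
  \<open>A\<close>, \<open>B\<close> and \<open>N\<close>, but not on \<open>n\<close>.\<close>

lemma sum_word_product_deviation_le: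
  fixes A B :: "complex^'d^'d" and N :: "complex^'d^'d \<Rightarrow> real"
  assumes N: "submult_norm N"
  obtains C where "C \<ge> 0"
    "\<And>n. n > 0 \<Longrightarrow> (\<Sum>w\<in>words n. N (word_product A B n w - matexp (A + B))) \<le> C / sqrt (real n) * card (words n)"
proof -
  obtain c where c: "c > 0" "\<And>X. N X \<le> c * norm (endo_of_matrix X)"
    using submult_norm_le_endo [OF N] by blast
  define m where "m = (1/2) *\<^sub>R (endo_of_matrix A + endo_of_matrix B)"
  define d where "d = (1/2) *\<^sub>R (endo_of_matrix A - endo_of_matrix B)"
  define K where "K = 4 * (norm m + norm d)\<^sup>2 * exp (6 * (norm m + norm d))"
  have K0: "K \<ge> 0" by (simp add: K_def)
  have letter: "endo_of_matrix (letter_matrix A B l) = m + letter_sign l *\<^sub>R d" for l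
    by (cases l) (simp_all add: m_def d_def letter_sign_def algebra_simps scaleR_add_left [symmetric])
  have m2: "endo_of_matrix (A + B) = 2 *\<^sub>R m"
    by (simp add: m_def endo_of_matrix_add)
  have dev: "N (word_product A B n w - matexp (A + B))
      \<le> c * K * ((\<Sum>k<2 * n. \<bar>\<Sum>i<Suc k. letter_sign (w ! i)\<bar>) / (real n)\<^sup>2 + 1 / real n)"
    if n: "n > 0" and w: "w \<in> words n" for n w
  proof -
    have len: "length w = 2 * n"
      using w by (simp add: words_def)
    have map_w: "map f w = map (\<lambda>i. f (w ! i)) [0..<2 * n]" for f :: "letter \<Rightarrow> (complex^'d) endo"
      by (rule nth_equalityI) (simp_all add: len)
    have "endo_of_matrix (word_product A B n w - matexp (A + B))
        = prod_list (map (\<lambda>i. exp ((m + letter_sign (w ! i) *\<^sub>R d) /\<^sub>R real n)) [0..<2 * n]) - exp (2 *\<^sub>R m)"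
      by (simp add: linear_diff [OF linear_endo_of_matrix] endo_of_word_product letter
          endo_of_matrix_matexp m2 map_w)
    also have "norm \<dots> \<le> K * ((\<Sum>k<2 * n. \<bar>\<Sum>i<Suc k. letter_sign (w ! i)\<bar>) / (real n)\<^sup>2 + 1 / real n)"
      unfolding K_def
      by (rule prod_list_exp_deviation) (simp_all add: n sum_letter_sign_word [OF w])
    finally have "c * norm (endo_of_matrix (word_product A B n w - matexp (A + B)))
        \<le> c * (K * ((\<Sum>k<2 * n. \<bar>\<Sum>i<Suc k. letter_sign (w ! i)\<bar>) / (real n)\<^sup>2 + 1 / real n))"
      using c(1) by (simp only: mult_le_cancel_left_pos)
    then show ?thesis
      unfolding mult.assoc by (rule order.trans [OF c(2)])
  qed
  show ?thesis
  proof
    \<comment> \<open>The 4 is 3 from the partial sums plus 1 from the remainder, using 1/n \<le>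
      1/sqrt n.\<close>
    show "c * K * 4 \<ge> 0" using c K0 by simp
    fix n :: nat assume n: "n > 0"
    let ?W = "real (card (words n))"
    have "(\<Sum>w\<in>words n. N (word_product A B n w - matexp (A + B)))
      \<le> (\<Sum>w\<in>words n. c * K * ((\<Sum>k<2 * n. \<bar>\<Sum>i<Suc k. letter_sign (w ! i)\<bar>) / (real n)\<^sup>2 + 1 / real n))"
      by (intro sum_mono dev n)
    also have "\<dots> = c * K * ((\<Sum>w\<in>words n. \<Sum>k<2 * n. \<bar>\<Sum>i<Suc k. letter_sign (w ! i)\<bar>) / (real n)\<^sup>2 + ?W / real n)"
      by (simp add: sum_distrib_left [symmetric] sum.distrib sum_divide_distrib [symmetric] del: sum.lessThan_Suc)
    also have "\<dots> \<le> c * K * (3 * real n * sqrt (real n) * ?W / (real n)\<^sup>2 + ?W / sqrt (real n))"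
    proof (intro mult_left_mono add_mono divide_right_mono sum_abs_walk_le n)
      have "sqrt (real n) \<le> real n"
        using n by (simp add: real_le_lsqrt power2_eq_square)
      then show "?W / real n \<le> ?W / sqrt (real n)"
        using n by (intro divide_left_mono) auto
    qed (use c K0 in auto)
    also have "3 * real n * sqrt (real n) * ?W / (real n)\<^sup>2 = 3 * ?W / sqrt (real n)"
      using n by (simp add: power2_eq_square field_simps)
    finally show "(\<Sum>w\<in>words n. N (word_product A B n w - matexp (A + B))) \<le> c * K * 4 / sqrt (real n) * ?W"
      by (simp add: algebra_simps)
  qed
qed

theorem theorem2:
  fixes A B :: "complex^'d^'d" and N :: "complex^'d^'d \<Rightarrow> real"
  assumes "submult_norm N"
  shows "(\<lambda>n. real (card {w \<in> words n.
                  N (word_product A B n w - matexp (A + B)) < sqrt (ln (real n) / real n)})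
              / real (card (words n))) \<longlonglongrightarrow> 1"
proof -
  obtain C where C: "C \<ge> 0"
    "\<And>n. n > 0 \<Longrightarrow> (\<Sum>w\<in>words n. N (word_product A B n w - matexp (A + B))) \<le> C / sqrt (real n) * card (words n)"
    using sum_word_product_deviation_le [OF assms, of A B] by blast
  define err where "err n w = N (word_product A B n w - matexp (A + B))" for n w
  define t where "t n = sqrt (ln (real n) / real n)" for n
  have err0: "err n w \<ge> 0" for n w
    using assms by (simp add: err_def submult_norm_def)
  have W: "real (card (words n)) > 0" for n
    using finite_words [of n] words_nonempty [of n] by (simp add: card_gt_0_iff)
  have upper: "real (card {w \<in> words n. err n w < t n}) / real (card (words n)) \<le> 1" for n
    using W [of n] by (simp add: card_mono finite_words)
  \<comment> \<open>From n = 2 on, ln n is positive, hence so is the threshold.\<close>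
  have lower: "1 - C / sqrt (ln (real n)) \<le> real (card {w \<in> words n. err n w < t n}) / real (card (words n))"
    if n: "n \<ge> 2" for n
  proof -
    let ?G = "{w \<in> words n. err n w < t n}" and ?B = "{w \<in> words n. \<not> err n w < t n}"
    have ln: "ln (real n) > 0" using n by simp
    then have t: "t n > 0" using n by (simp add: t_def)
    \<comment> \<open>Markov's inequality: every exceptional word contributes at least
      \<open>t n\<close> to the total error.\<close>
    have "real (card ?B) * t n = (\<Sum>w\<in>?B. t n)" by simp
    also have "\<dots> \<le> (\<Sum>w\<in>?B. err n w)"
      by (intro sum_mono) auto
    also have "\<dots> \<le> (\<Sum>w\<in>words n. err n w)"
      by (intro sum_mono2 finite_words) (auto simp: err0)
    also have "\<dots> \<le> C / sqrt (real n) * card (words n)"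
      unfolding err_def using n by (intro C) simp
    \<comment> \<open>Since 1/sqrt n equals \<open>t n\<close> divided by sqrt(ln n), the threshold
      can be cancelled.\<close>
    also have "\<dots> = C / sqrt (ln (real n)) * card (words n) * t n"
      using ln n by (simp add: t_def real_sqrt_divide)
    finally have bad: "real (card ?B) \<le> C / sqrt (ln (real n)) * card (words n)"
      using t by (simp only: mult_le_cancel_right_pos)
    have "card (words n) = card (?G \<union> ?B)"
      by (rule arg_cong [where f = card]) auto
    also have "\<dots> = card ?G + card ?B"
      by (rule card_Un_disjoint) (auto simp: finite_words)
    finally have "real (card (words n)) = real (card ?G) + real (card ?B)" by simp
    with bad have "(1 - C / sqrt (ln (real n))) * real (card (words n)) \<le> real (card ?G)"
      by (simp add: left_diff_distrib)
    then show ?thesis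
      using W [of n] by (simp add: pos_le_divide_eq)
  qed
  have "filterlim (\<lambda>n. sqrt (ln (real n))) at_top sequentially"
    by (intro filterlim_compose [OF sqrt_at_top] filterlim_compose [OF ln_at_top] filterlim_real_sequentially)
  then have "(\<lambda>n. C / sqrt (ln (real n))) \<longlonglongrightarrow> 0"
    by (rule real_tendsto_divide_at_top [OF tendsto_const])
  then have "(\<lambda>n. 1 - C / sqrt (ln (real n))) \<longlonglongrightarrow> 1"
    using tendsto_diff [OF tendsto_const [of 1]] by fastforce
  then have "(\<lambda>n. real (card {w \<in> words n. err n w < t n}) / real (card (words n))) \<longlonglongrightarrow> 1"
    \<comment> \<open>The lower bound holds only from n = 2 on, which is enough for the
      squeeze.\<close>
    by (rule tendsto_sandwich [OF _ _ _ tendsto_const, rotated 2])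
      (use lower upper in \<open>auto intro: eventually_sequentiallyI\<close>)
  then show ?thesis
    by (simp add: err_def t_def)
qed

end
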